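(* Let $K\subset\mathbb{R}^n$ be a compact set of Lebesgue measure $\leq\varepsilon$. Then there is a smooth map $\phi\colon\mathbb{R}^n\to\mathbb{R}^n$ such that the displacement functions satisfy $\|\Delta_i\phi\|\leq\varepsilon^{1/n}$ for $i=1,\dots,n$, and $\phi(K)$ has Lebesgue measure zero.
   Context: For a map $\phi\colon\mathbb{R}^n\to\mathbb{R}^n$ and $i=1,\dots,n$, the $i$-th displacement function $\Delta_i\phi\colon\mathbb{R}^n\to[0,\infty)$ is $\Delta_i\phi(x)=|p_i(x)-p_i(\phi(x))|$, where $p_i\colon\mathbb{R}^n\to\mathbb{R}$ is the projection on the $i$-th coordinate. $\|\cdot\|$ applied to a function denotes the uniform norm: $\|\Delta_i\phi\|=\sup_{x\in\mathbb{R}^n}\Delta_i\phi(x)$. *)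

theory Defs
  imports "HOL-Analysis.Analysis"
begin

(* C^k on the whole space: in finite dimension, f is C^(k+1) iff it is differentiable
   everywhere and all its directional derivatives x |-> Df(x) v are C^k. *)
primrec continuously_differentiable ::
  "nat \<Rightarrow> ('a::euclidean_space \<Rightarrow> 'b::euclidean_space) \<Rightarrow> bool" where
  "continuously_differentiable 0 f \<longleftrightarrow> continuous_on UNIV f"
| "continuously_differentiable (Suc k) f \<longleftrightarrow>
     (\<forall>x. f differentiable (at x)) \<and>
     (\<forall>v. continuously_differentiable k (\<lambda>x. frechet_derivative f (at x) v))"

definition smooth_map :: "('a::euclidean_space \<Rightarrow> 'b::euclidean_space) \<Rightarrow> bool" where
  "smooth_map f \<longleftrightarrow> (\<forall>k. continuously_differentiable k f)"

definition displacement :: "'n \<Rightarrow> (real ^ 'n \<Rightarrow> real ^ 'n) \<Rightarrow> real ^ 'n \<Rightarrow> real" where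
  "displacement i \<phi> x = \<bar>x $ i - \<phi> x $ i\<bar>"

(* Valued in ennreal so that an unbounded function has norm infinity; the supremum of an
   unbounded set is unspecified in type real. *)
definition uniform_norm :: "('a \<Rightarrow> real) \<Rightarrow> ennreal" where
  "uniform_norm f = (SUP x. ennreal \<bar>f x\<bar>)"

end

theory Submission
  imports Defs
begin

text \<open>Take a cubical lattice of side \<open>s = 3/2 * \<epsilon> powr (1/n)\<close>. Since \<open>K\<close> has measure less than
  \<open>s ^ n\<close>, its projection to the torus cannot be onto, so \<open>K\<close> misses some translate
  \<open>p + s \<int>\<^sup>n\<close>, and by compactness even a neighbourhood of it. Let \<open>\<phi>\<close> apply in each coordinate a
  smooth staircase that is constant except near the points of \<open>p\<^sub>i + s \<int>\<close>. Each point of \<open>K\<close> has a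
  coordinate in the constant region, so \<open>\<phi> ` K\<close> lies in a countable union of hyperplanes. The
  displacement is at most slightly more than \<open>s / 2\<close>, which the factor \<open>3/2 < 2\<close> absorbs.\<close>

section \<open>Calculus of C^k maps\<close>

text \<open>Derivatives are unique, so an explicit derivative \<open>F\<close> may replace
  \<open>frechet_derivative\<close>. Most inductions on \<open>k\<close> below feed a
  differentiation rule into this lemma.\<close>

lemma continuously_differentiable_SucI:
  assumes "\<And>x. (f has_derivative F x) (at x)"
    and "\<And>v. continuously_differentiable k (\<lambda>x. F x v)"
  shows "continuously_differentiable (Suc k) f"
proof -
  have "frechet_derivative f (at x) = F x" for x
    using frechet_derivative_at[OF assms(1)] by simp
  then show ?thesis
    using assms by (auto simp: differentiable_def)
qed

lemma continuously_differentiable_SucE: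
  assumes "continuously_differentiable (Suc k) f"
  obtains F where "\<And>x. (f has_derivative F x) (at x)"
    and "\<And>v. continuously_differentiable k (\<lambda>x. F x v)"
proof
  show "(f has_derivative frechet_derivative f (at x)) (at x)" for x
    using assms frechet_derivative_works by auto
qed (use assms in auto)

text \<open>Differentiability gives continuity in the base case; the induction step lowers the order
  of the directional derivatives.\<close>

lemma continuously_differentiable_SucD:
  "continuously_differentiable (Suc k) f \<Longrightarrow> continuously_differentiable k f"
proof (induction k arbitrary: f)
  case 0
  then show ?case
    by (auto intro!: differentiable_imp_continuous_on simp: differentiable_on_def
        intro: differentiable_at_withinI)
next
  case (Suc k)
  obtain F where F: "\<And>x. (f has_derivative F x) (at x)"
    "\<And>v. continuously_differentiable (Suc k) (\<lambda>x. F x v)"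
    using Suc.prems by (rule continuously_differentiable_SucE) blast
  show ?case
    by (rule continuously_differentiable_SucI[OF F(1) Suc.IH[OF F(2)]])
qed

lemma continuously_differentiable_const: "continuously_differentiable k (\<lambda>x. c)"
proof (induction k arbitrary: c)
  case (Suc k)
  show ?case
    by (rule continuously_differentiable_SucI[OF has_derivative_const Suc.IH])
qed simp

lemma continuously_differentiable_linear:
  assumes "bounded_linear f"
  shows "continuously_differentiable k f"
proof (cases k)
  case 0
  then show ?thesis
    using assms by (simp add: linear_continuous_on)
next
  case (Suc m)
  show ?thesis
    unfolding Suc
    by (rule continuously_differentiable_SucI[OF bounded_linear_imp_has_derivative[OF assms]
          continuously_differentiable_const])
qed

lemma continuously_differentiable_add:
  "continuously_differentiable k f \<Longrightarrow> continuously_differentiable k g \<Longrightarrow>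
     continuously_differentiable k (\<lambda>x. f x + g x)"
proof (induction k arbitrary: f g)
  case 0
  then show ?case by (simp add: continuous_on_add)
next
  case (Suc k)
  obtain F where F: "\<And>x. (f has_derivative F x) (at x)"
    "\<And>v. continuously_differentiable k (\<lambda>x. F x v)"
    using Suc.prems(1) by (rule continuously_differentiable_SucE) blast
  obtain G where G: "\<And>x. (g has_derivative G x) (at x)"
    "\<And>v. continuously_differentiable k (\<lambda>x. G x v)"
    using Suc.prems(2) by (rule continuously_differentiable_SucE) blast
  show ?case
    by (rule continuously_differentiable_SucI[OF has_derivative_add[OF F(1) G(1)]
          Suc.IH[OF F(2) G(2)]])
qed

lemma continuously_differentiable_sum:
  "(\<And>i. i \<in> A \<Longrightarrow> continuously_differentiable k (f i)) \<Longrightarrow>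
     continuously_differentiable k (\<lambda>x. \<Sum>i\<in>A. f i x)"
  by (induction A rule: infinite_finite_induct)
    (auto intro: continuously_differentiable_const continuously_differentiable_add)

lemma continuously_differentiable_mult:
  fixes f g :: "'a::euclidean_space \<Rightarrow> real"
  shows "continuously_differentiable k f \<Longrightarrow> continuously_differentiable k g \<Longrightarrow>
     continuously_differentiable k (\<lambda>x. f x * g x)"
proof (induction k arbitrary: f g)
  case 0
  then show ?case by (simp add: continuous_on_mult)
next
  case (Suc k)
  obtain F where F: "\<And>x. (f has_derivative F x) (at x)"
    "\<And>v. continuously_differentiable k (\<lambda>x. F x v)"
    using Suc.prems(1) by (rule continuously_differentiable_SucE) blast
  obtain G where G: "\<And>x. (g has_derivative G x) (at x)"
    "\<And>v. continuously_differentiable k (\<lambda>x. G x v)"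
    using Suc.prems(2) by (rule continuously_differentiable_SucE) blast
  \<comment> \<open>The product rule leaves one factor undifferentiated in each summand, so the
    induction hypothesis needs \<open>f\<close> and \<open>g\<close> themselves at order
    \<open>k\<close>.\<close>
  note fg = Suc.prems[THEN continuously_differentiable_SucD]
  show ?case
    by (rule continuously_differentiable_SucI[OF has_derivative_mult[OF F(1) G(1)]
          continuously_differentiable_add[OF Suc.IH[OF fg(1) G(2)] Suc.IH[OF F(2) fg(2)]]])
qed

lemma continuously_differentiable_inverse:
  fixes f :: "'a::euclidean_space \<Rightarrow> real"
  assumes "\<And>x. f x \<noteq> 0"
  shows "continuously_differentiable k f \<Longrightarrow> continuously_differentiable k (\<lambda>x. inverse (f x))"
proof (induction k)
  case 0
  then show ?case using assms by (simp add: continuous_on_inverse)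
next
  case (Suc k)
  obtain F where F: "\<And>x. (f has_derivative F x) (at x)"
    "\<And>v. continuously_differentiable k (\<lambda>x. F x v)"
    using Suc.prems by (rule continuously_differentiable_SucE) blast
  have inv: "continuously_differentiable k (\<lambda>x. inverse (f x))"
    using Suc.IH continuously_differentiable_SucD[OF Suc.prems] by blast
  \<comment> \<open>The sign is written as a constant factor, so that the derivative is a pure
    product. The reciprocal recurs in it, one order lower.\<close>
  have "((\<lambda>x. inverse (f x)) has_derivative
      (\<lambda>v. (- 1) * (inverse (f x) * F x v * inverse (f x)))) (at x)" for x
    using Deriv.has_derivative_inverse[OF assms F(1)] by simp
  then show ?case
    by (rule continuously_differentiable_SucI)
      (intro continuously_differentiable_mult continuously_differentiable_const inv F(2))
qed

lemma continuously_differentiable_bounded_linear: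
  assumes "bounded_linear L"
  shows "continuously_differentiable k f \<Longrightarrow> continuously_differentiable k (\<lambda>x. L (f x))"
proof (induction k arbitrary: f)
  case 0
  then show ?case using bounded_linear.continuous_on[OF assms] by simp
next
  case (Suc k)
  obtain F where F: "\<And>x. (f has_derivative F x) (at x)"
    "\<And>v. continuously_differentiable k (\<lambda>x. F x v)"
    using Suc.prems by (rule continuously_differentiable_SucE) blast
  show ?case
    by (rule continuously_differentiable_SucI[OF bounded_linear.has_derivative[OF assms F(1)]
          Suc.IH[OF F(2)]])
qed

text \<open>The derivative in direction \<open>v\<close> is the derivative of \<open>f\<close> in
  the fixed direction \<open>L v\<close>, precomposed with the same affine map. The induction
  therefore closes on itself.\<close>

lemma continuously_differentiable_compose_affine:
  assumes "bounded_linear L"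
  shows "continuously_differentiable k f \<Longrightarrow> continuously_differentiable k (\<lambda>x. f (c + L x))"
proof (induction k arbitrary: f)
  case 0
  then show ?case
    using continuous_on_compose2[of UNIV f UNIV "\<lambda>x. c + L x"]
      continuous_on_add[OF continuous_on_const linear_continuous_on[OF assms]]
    by simp
next
  case (Suc k)
  obtain F where F: "\<And>x. (f has_derivative F x) (at x)"
    "\<And>v. continuously_differentiable k (\<lambda>x. F x v)"
    using Suc.prems by (rule continuously_differentiable_SucE) blast
  have aff: "((\<lambda>x. c + L x) has_derivative L) (at x)" for x
    using has_derivative_add[OF has_derivative_const bounded_linear_imp_has_derivative[OF assms]]
    by simp
  have "((\<lambda>x. f (c + L x)) has_derivative (\<lambda>v. F (c + L x) (L v))) (at x)" for x
    using has_derivative_compose[OF aff F(1)] .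
  then show ?case
    by (rule continuously_differentiable_SucI) (rule Suc.IH[OF F(2)])
qed

text \<open>Functions that agree on an open set have equal derivatives there, so the hypothesis
  passes to directional derivatives. This permits gluing functions defined by cases.\<close>

lemma continuously_differentiable_local:
  assumes "\<And>x. \<exists>U g. open U \<and> x \<in> U \<and> continuously_differentiable k g \<and> (\<forall>y\<in>U. f y = g y)"
  shows "continuously_differentiable k f"
  using assms
proof (induction k arbitrary: f)
  case 0
  have "isCont f x" for x
  proof -
    obtain U g where U: "open U" "x \<in> U" "continuous_on UNIV g" "\<forall>y\<in>U. f y = g y"
      using 0[of x] by auto
    have "eventually (\<lambda>y. f y = g y) (nhds x)"
      using U by (auto simp: eventually_nhds)
    moreover have "isCont g x"
      using U(3) by (simp add: continuous_on_eq_continuous_at)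
    ultimately show ?thesis using isCont_cong by blast
  qed
  then show ?case by (simp add: continuous_at_imp_continuous_on)
next
  case (Suc k)
  \<comment> \<open>The derivatives must agree on all of \<open>U\<close>, not only at
    \<open>x\<close>, to serve as local data for the induction hypothesis.\<close>
  have loc: "\<exists>U g. open U \<and> x \<in> U \<and> continuously_differentiable (Suc k) g \<and>
      (\<forall>y\<in>U. f y = g y \<and> (f has_derivative frechet_derivative g (at y)) (at y))" for x
  proof -
    obtain U g where U: "open U" "x \<in> U" "continuously_differentiable (Suc k) g" "\<forall>y\<in>U. f y = g y"
      using Suc.prems[of x] by blast
    have "(f has_derivative frechet_derivative g (at y)) (at y)" if "y \<in> U" for y
    proof (rule has_derivative_transform_within_open)
      show "(g has_derivative frechet_derivative g (at y)) (at y)"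
        using U(3) frechet_derivative_works by auto
    qed (use U that in auto)
    then show ?thesis using U by blast
  qed
  show ?case
  proof (rule continuously_differentiable_SucI)
    show "(f has_derivative frechet_derivative f (at x)) (at x)" for x
      using loc[of x] frechet_derivative_works differentiableI by blast
    show "continuously_differentiable k (\<lambda>x. frechet_derivative f (at x) v)" for v
    proof (rule Suc.IH)
      fix x
      obtain U g where U: "open U" "x \<in> U" "continuously_differentiable (Suc k) g"
        "\<And>y. y \<in> U \<Longrightarrow> (f has_derivative frechet_derivative g (at y)) (at y)"
        using loc[of x] by blast
      show "\<exists>U g. open U \<and> x \<in> U \<and> continuously_differentiable k g \<and>
          (\<forall>y\<in>U. frechet_derivative f (at y) v = g y)"
        using U frechet_derivative_at[OF U(4)]
        by (intro exI[of _ U] exI[of _ "\<lambda>y. frechet_derivative g (at y) v"]) auto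
    qed
  qed
qed

section \<open>A flat function at the origin\<close>

text \<open>The powers of \<open>1/x\<close> make this family closed under differentiation up to linear
  combinations.\<close>

definition flat_exp :: "nat \<Rightarrow> real \<Rightarrow> real" where
  "flat_exp n x = (if x > 0 then inverse x ^ n * exp (- inverse x) else 0)"

text \<open>This is the difference quotient at 0. On the right, the substitution y = 1/x turns it
  into y^(n+1) / exp y; on the left it vanishes identically.\<close>

lemma flat_exp_over_id_tendsto_0:
  "((\<lambda>x. flat_exp n x / x) \<longlongrightarrow> 0) (at 0)"
proof -
  have "((\<lambda>x::real. inverse x ^ Suc n / exp (inverse x)) \<longlongrightarrow> 0) (at_right 0)"
    by (rule filterlim_compose[OF tendsto_power_div_exp_0 filterlim_inverse_at_top_right])
  moreover have "\<forall>\<^sub>F x in at_right 0. inverse x ^ Suc n / exp (inverse x) = flat_exp n x / x"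
    by (auto simp: eventually_at_filter flat_exp_def exp_minus field_simps)
  ultimately have R: "((\<lambda>x. flat_exp n x / x) \<longlongrightarrow> 0) (at_right 0)"
    by (rule Lim_transform_eventually)
  have "\<forall>\<^sub>F x in at_left 0. 0 = flat_exp n x / x"
    by (auto simp: eventually_at_filter flat_exp_def)
  then have L: "((\<lambda>x. flat_exp n x / x) \<longlongrightarrow> 0) (at_left 0)"
    by (rule Lim_transform_eventually[OF tendsto_const])
  show ?thesis
    using L R by (rule filterlim_split_at)
qed

lemma has_field_derivative_flat_exp:
  "(flat_exp n has_field_derivative (flat_exp (n + 2) x + (- real n) * flat_exp (n + 1) x)) (at x)"
proof -
  consider "x < 0" | "x = 0" | "x > 0" by linarith
  then show ?thesis
  proof cases
    case 1
    have "(flat_exp n has_field_derivative 0) (at x)"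
      by (rule has_field_derivative_transform_within_open[OF DERIV_const[of 0], where S = "{..<0}"])
        (use 1 in \<open>auto simp: flat_exp_def\<close>)
    then show ?thesis using 1 by (simp add: flat_exp_def)
  next
    case 2
    then show ?thesis
      using flat_exp_over_id_tendsto_0[of n]
      by (simp add: has_field_derivative_iff flat_exp_def)
  next
    case 3
    have "((\<lambda>x. inverse x ^ n * exp (- inverse x)) has_field_derivative
        (flat_exp (n + 2) x + (- real n) * flat_exp (n + 1) x)) (at x)"
    \<comment> \<open>The power rule used is stated for exponents of the form \<open>Suc m\<close>,
      so exponent 0 is treated apart.\<close>
    proof (cases n)
      case 0
      then show ?thesis
        using 3 by (auto intro!: derivative_eq_intros simp: flat_exp_def field_simps power2_eq_square)
    next
      case (Suc m)
      have "((\<lambda>x. exp (- inverse x)) has_field_derivative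
          exp (- inverse x) * inverse x ^ 2) (at x)"
        using 3 by (auto intro!: derivative_eq_intros simp: power2_eq_square)
      from DERIV_mult[OF DERIV_power_Suc[OF DERIV_inverse] this] show ?thesis
        using 3 by (simp add: flat_exp_def Suc power2_eq_square algebra_simps)
    qed
    then show ?thesis
      by (rule has_field_derivative_transform_within_open[where S = "{0<..}"])
        (use 3 in \<open>auto simp: flat_exp_def\<close>)
  qed
qed

lemma continuously_differentiable_flat_exp: "continuously_differentiable k (flat_exp n)"
proof (induction k arbitrary: n)
  case 0
  show ?case
    using has_field_derivative_flat_exp[THEN DERIV_isCont]
    by (simp add: continuous_at_imp_continuous_on)
next
  case (Suc k)
  show ?case
    by (rule continuously_differentiable_SucI[OF
          has_field_derivative_flat_exp[THEN has_field_derivative_imp_has_derivative]])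
      (intro continuously_differentiable_mult continuously_differentiable_const
        continuously_differentiable_add Suc.IH)
qed

section \<open>The smooth step and the smooth staircase\<close>

text \<open>The standard smooth transition from 0 to 1 over the unit interval, built from exp(-1/t).
  The quotient is spelled with \<open>inverse\<close> to match the closure lemmas.\<close>

definition smooth_step :: "real \<Rightarrow> real" where
  "smooth_step t = flat_exp 0 t * inverse (flat_exp 0 t + flat_exp 0 (1 - t))"

lemma flat_exp_nonneg: "0 \<le> flat_exp n x"
  and flat_exp_pos: "x > 0 \<Longrightarrow> 0 < flat_exp n x"
  and flat_exp_eq_0: "x \<le> 0 \<Longrightarrow> flat_exp n x = 0"
  by (auto simp: flat_exp_def)

text \<open>At least one of \<open>t\<close> and \<open>1 - t\<close> is positive.\<close>

lemma smooth_step_denominator_pos: "0 < flat_exp 0 t + flat_exp 0 (1 - t)"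
  using flat_exp_pos[of t 0] flat_exp_pos[of "1 - t" 0] flat_exp_nonneg[of 0 t]
    flat_exp_nonneg[of 0 "1 - t"]
  by (cases "t > 0") auto

lemma smooth_step_nonneg: "0 \<le> smooth_step t"
  using smooth_step_denominator_pos[of t] flat_exp_nonneg[of 0 t] by (simp add: smooth_step_def)

lemma smooth_step_le_1: "smooth_step t \<le> 1"
  using smooth_step_denominator_pos[of t] flat_exp_nonneg[of 0 "1 - t"]
  by (simp add: smooth_step_def field_simps)

lemma smooth_step_eq_0: "t \<le> 0 \<Longrightarrow> smooth_step t = 0"
  by (simp add: smooth_step_def flat_exp_eq_0)

lemma smooth_step_eq_1: "1 \<le> t \<Longrightarrow> smooth_step t = 1"
  using smooth_step_denominator_pos[of t] by (simp add: smooth_step_def flat_exp_eq_0)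

lemma continuously_differentiable_smooth_step: "continuously_differentiable k smooth_step"
proof -
  have "continuously_differentiable k (\<lambda>t. flat_exp 0 (1 - t))"
    using continuously_differentiable_compose_affine[OF bounded_linear_minus[OF bounded_linear_ident]
        continuously_differentiable_flat_exp, of k 0 1]
    by simp
  moreover have "flat_exp 0 t + flat_exp 0 (1 - t) \<noteq> 0" for t
    using smooth_step_denominator_pos[of t] by simp
  ultimately show ?thesis
    unfolding smooth_step_def
    by (intro continuously_differentiable_mult continuously_differentiable_inverse
        continuously_differentiable_add continuously_differentiable_flat_exp)
qed

text \<open>A smoothed floor function shifted by 1/2 so as to stay close to the identity. For
  \<delta> < 1/2, each unit rise takes place within \<delta> of an integer, and the plateaus between
  have half-integer heights.\<close>

definition smooth_staircase :: "real \<Rightarrow> real \<Rightarrow> real" where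
  "smooth_staircase \<delta> u =
     of_int (round u) - 1/2 + smooth_step ((u - of_int (round u) + \<delta>) / (2 * \<delta>))"

text \<open>A single formula works across k - 1/2, where \<open>round\<close> jumps: between the
  rises at k - 1 and k, the former is complete and the latter has not begun, so both formulas give k
  - 1/2.\<close>

lemma smooth_staircase_near:
  assumes \<delta>: "0 < \<delta>" "\<delta> < 1/2" and u: "of_int k - 1 + \<delta> < u" "u < of_int k + 1/2"
  shows "smooth_staircase \<delta> u = of_int k - 1/2 + smooth_step ((u - of_int k + \<delta>) / (2 * \<delta>))"
proof (cases "of_int k - 1/2 \<le> u")
  case True
  then have "round u = k"
    using u by (intro round_unique) auto
  then show ?thesis by (simp add: smooth_staircase_def)
next
  case False
  then have r: "round u = k - 1"
    using u \<delta> by (intro round_unique) auto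
  have "smooth_step ((u - of_int k + \<delta>) / (2 * \<delta>)) = 0"
    using False \<delta> by (intro smooth_step_eq_0) (auto simp: field_simps)
  moreover have "smooth_step ((u - of_int (k - 1) + \<delta>) / (2 * \<delta>)) = 1"
    using u \<delta> by (intro smooth_step_eq_1) (auto simp: field_simps)
  ultimately show ?thesis by (simp add: smooth_staircase_def r)
qed

lemma continuously_differentiable_smooth_staircase:
  assumes \<delta>: "0 < \<delta>" "\<delta> < 1/2"
  shows "continuously_differentiable m (smooth_staircase \<delta>)"
proof (rule continuously_differentiable_local)
  fix u :: real
  define k where "k = round u"
  \<comment> \<open>The argument of the step is split into a constant plus a linear term, the form
    required for affine precomposition.\<close>
  define g where "g = (\<lambda>w. of_int k - 1/2 + smooth_step ((\<delta> - of_int k) / (2 * \<delta>) + w / (2 * \<delta>)))"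
  have "continuously_differentiable m g"
    unfolding g_def
    by (intro continuously_differentiable_add continuously_differentiable_const
        continuously_differentiable_compose_affine bounded_linear_divide
        continuously_differentiable_smooth_step)
  \<comment> \<open>Rounding gives k - 1/2 \<le> u < k + 1/2, and \<delta> < 1/2 puts this range
    inside the open interval.\<close>
  moreover have "u \<in> {of_int k - 1 + \<delta><..<of_int k + 1/2}"
    using of_int_round_le[of u] of_int_round_gt[of u] \<delta> by (auto simp: k_def)
  moreover have "smooth_staircase \<delta> w = g w" if "w \<in> {of_int k - 1 + \<delta><..<of_int k + 1/2}" for w
    using smooth_staircase_near[OF \<delta>, of k w] that
    by (simp add: g_def add_divide_distrib diff_divide_distrib algebra_simps)
  ultimately show "\<exists>U g. open U \<and> u \<in> U \<and> continuously_differentiable m g \<and>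
      (\<forall>w\<in>U. smooth_staircase \<delta> w = g w)"
    by (intro exI[of _ "{of_int k - 1 + \<delta><..<of_int k + 1/2}"] exI[of _ g]) auto
qed

text \<open>At distance at least \<delta> from the nearest integer the step is saturated at 0 or
  1.\<close>

lemma smooth_staircase_flat:
  assumes \<delta>: "0 < \<delta>" and u: "\<delta> \<le> \<bar>u - of_int (round u)\<bar>"
  shows "smooth_staircase \<delta> u = of_int (round u) + (if u < of_int (round u) then - 1/2 else 1/2)"
proof (cases "u < of_int (round u)")
  case True
  then have "smooth_step ((u - of_int (round u) + \<delta>) / (2 * \<delta>)) = 0"
    using u \<delta> by (intro smooth_step_eq_0) (auto simp: field_simps)
  then show ?thesis using True by (simp add: smooth_staircase_def)
next
  case False
  then have "smooth_step ((u - of_int (round u) + \<delta>) / (2 * \<delta>)) = 1"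
    using u \<delta> by (intro smooth_step_eq_1) (auto simp: field_simps)
  then show ?thesis using False by (simp add: smooth_staircase_def)
qed

text \<open>On a plateau the value is a half-integer within 1/2 of \<open>u\<close>. During a rise,
  \<open>u\<close> is within \<delta> of the integer and the value within 1/2 of it.\<close>

lemma abs_smooth_staircase_diff_le:
  assumes \<delta>: "0 < \<delta>"
  shows "\<bar>u - smooth_staircase \<delta> u\<bar> \<le> 1/2 + \<delta>"
proof (cases "\<delta> \<le> \<bar>u - of_int (round u)\<bar>")
  case True
  then show ?thesis
    using smooth_staircase_flat[OF \<delta> True] of_int_round_abs_le[of u] \<delta> by (auto split: if_splits)
next
  case False
  then show ?thesis
    using smooth_step_nonneg[of "(u - of_int (round u) + \<delta>) / (2 * \<delta>)"]
      smooth_step_le_1[of "(u - of_int (round u) + \<delta>) / (2 * \<delta>)"]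
    unfolding smooth_staircase_def by linarith
qed

section \<open>Smooth maps assembled from coordinate functions\<close>

text \<open>The map is the finite sum of its coordinates times the basis vectors, so closure under
  sums and bounded linear maps applies.\<close>

lemma smooth_map_componentwise:
  fixes f :: "'n::finite \<Rightarrow> 'a::euclidean_space \<Rightarrow> real"
  assumes "\<And>i. smooth_map (f i)"
  shows "smooth_map (\<lambda>x. \<chi> i. f i x)"
proof -
  have "continuously_differentiable k (\<lambda>x. \<Sum>i\<in>UNIV. f i x *\<^sub>R axis i (1::real))" for k
    using assms
    by (intro continuously_differentiable_sum
        continuously_differentiable_bounded_linear[OF bounded_linear_scaleR_left])
      (auto simp: smooth_map_def)
  moreover have "(\<lambda>x. \<Sum>i\<in>UNIV. f i x *\<^sub>R axis i (1::real)) = (\<lambda>x. \<chi> i. f i x)"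
    by (auto simp: vec_eq_iff axis_def if_distrib cong: if_cong)
  ultimately show ?thesis by (simp add: smooth_map_def)
qed

section \<open>A translated lattice at positive distance from a compact set\<close>

lemma finite_vec_components_in:
  assumes "finite S"
  shows "finite {z :: 'a ^ 'n::finite. \<forall>i. z $ i \<in> S}"
proof -
  have "{z :: 'a ^ 'n. \<forall>i. z $ i \<in> S} \<subseteq> vec_lambda ` (UNIV \<rightarrow>\<^sub>E S)"
  proof
    fix z :: "'a ^ 'n" assume "z \<in> {z. \<forall>i. z $ i \<in> S}"
    then show "z \<in> vec_lambda ` (UNIV \<rightarrow>\<^sub>E S)"
      by (intro image_eqI[of _ _ "vec_nth z"]) auto
  qed
  then show ?thesis
    by (rule finite_subset) (intro finite_imageI finite_PiE; use assms in simp)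
qed

text \<open>If every translate met \<open>K\<close>, the pieces of \<open>K\<close> in the lattice
  cells, moved back to the base cell, would cover a cube of volume s^n. Translation preserves
  measure, so \<open>K\<close> would have at least that measure.\<close>

lemma exists_translated_lattice_disjoint:
  fixes K :: "(real ^ 'n::finite) set"
  assumes K: "compact K" and s: "0 < s" and less: "measure lebesgue K < s ^ CARD('n)"
  obtains p :: "real ^ 'n" where "\<And>x. x \<in> K \<Longrightarrow> \<exists>i. (x $ i - p $ i) / s \<notin> \<int>"
proof (rule ccontr)
  assume contra: "\<not> thesis"
  have ex: "\<exists>x\<in>K. \<forall>i. (x $ i - p $ i) / s \<in> \<int>" for p :: "real ^ 'n"
    using contra that[of p] by blast
  \<comment> \<open>\<open>cell x\<close> indexes the half-open cube of side \<open>s\<close>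
    containing \<open>x\<close>, \<open>shift\<close> gives its lower corner, and \<open>P z\<close>
    is the piece of \<open>K\<close> in cube \<open>z\<close>.\<close>
  define cell :: "real ^ 'n \<Rightarrow> int ^ 'n" where "cell x = (\<chi> i. \<lfloor>x $ i / s\<rfloor>)" for x
  define shift :: "int ^ 'n \<Rightarrow> real ^ 'n" where "shift z = (\<chi> i. s * of_int (z $ i))" for z
  define P where "P z = K \<inter> {x. cell x = z}" for z
  have "finite (cell ` K)"
  proof -
    obtain B where B: "\<And>x. x \<in> K \<Longrightarrow> norm x \<le> B"
      using compact_imp_bounded[OF K] by (auto simp: bounded_iff)
    have "cell x $ i \<in> {\<lfloor>- B / s\<rfloor>..\<lfloor>B / s\<rfloor>}" if "x \<in> K" for x i
    proof -
      have "\<bar>x $ i\<bar> \<le> B" using B[OF that] component_le_norm_cart[of x i] by linarith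
      then have "- B \<le> x $ i" "x $ i \<le> B" by linarith+
      then show ?thesis
        using s divide_right_mono[of "- B" "x $ i" s] divide_right_mono[of "x $ i" B s]
        by (auto simp: cell_def intro!: floor_mono)
    qed
    then have "cell ` K \<subseteq> {z. \<forall>i. z $ i \<in> {\<lfloor>- B / s\<rfloor>..\<lfloor>B / s\<rfloor>}}" by blast
    then show ?thesis
      by (rule finite_subset) (rule finite_vec_components_in, simp)
  qed
  have "{x. cell x = z} \<in> sets borel" for z
  proof -
    have "{x. cell x = z} = {x \<in> space borel. \<forall>i. \<lfloor>x $ i / s\<rfloor> = z $ i}"
      by (auto simp: cell_def vec_eq_iff)
    also have "\<dots> \<in> sets borel" by measurable
    finally show ?thesis .
  qed
  then have P: "P z \<in> lmeasurable" for z
    unfolding P_def by (intro fmeasurable_Int_fmeasurable lmeasurable_compact[OF K]) auto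
  then have Q: "(\<lambda>x. - shift z + x) ` P z \<in> lmeasurable" for z
    by (rule measurable_translation)
  \<comment> \<open>For \<open>p\<close> in the open cube, some \<open>x\<close> in \<open>K\<close>
    differs from \<open>p\<close> by a lattice vector. As 0 < p_i < s, the floor of x_i / s recovers
    that vector, so moving the cell of \<open>x\<close> back takes \<open>x\<close> to
    \<open>p\<close>.\<close>
  have cover: "box 0 (\<chi> i. s) \<subseteq> (\<Union>z\<in>cell ` K. (\<lambda>x. - shift z + x) ` P z)"
  proof
    fix p :: "real ^ 'n" assume p: "p \<in> box 0 (\<chi> i. s)"
    obtain x where x: "x \<in> K" "\<And>i. (x $ i - p $ i) / s \<in> \<int>" using ex by blast
    have "s * of_int (cell x $ i) = x $ i - p $ i" for i
    proof -
      obtain m where m: "(x $ i - p $ i) / s = of_int m" using x(2) by (rule Ints_cases)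
      have pi: "0 < p $ i" "p $ i < s" using p by (auto simp: mem_box_cart)
      have xi: "x $ i = s * of_int m + p $ i" using m s by (simp add: field_simps)
      then have "x $ i / s = of_int m + p $ i / s" using s by (simp add: field_simps)
      moreover have "0 \<le> p $ i / s" "p $ i / s < 1" using pi s by auto
      ultimately have "\<lfloor>x $ i / s\<rfloor> = m" by (simp add: floor_unique)
      then show ?thesis using xi by (simp add: cell_def)
    qed
    then have "p = - shift (cell x) + x" by (simp add: shift_def vec_eq_iff)
    then show "p \<in> (\<Union>z\<in>cell ` K. (\<lambda>x. - shift z + x) ` P z)"
      using x(1) by (auto simp: P_def)
  qed
  \<comment> \<open>The volume formula concerns nonempty closed boxes; the open cube covered above
    has the same measure.\<close>
  have ne: "cbox 0 (\<chi> i. s) \<noteq> ({} :: (real ^ 'n) set)"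
    using s by (auto simp: interval_ne_empty_cart)
  have "s ^ CARD('n) = measure lborel (cbox 0 (\<chi> i. s) :: (real ^ 'n) set)"
    using content_cbox_cart[OF ne] by simp
  also have "\<dots> = measure lborel (box 0 (\<chi> i. s) :: (real ^ 'n) set)"
    by (simp only: measure_lborel_cbox_eq measure_lborel_box_eq)
  also have "\<dots> = measure lebesgue (box 0 (\<chi> i. s) :: (real ^ 'n) set)"
    by simp
  also have "\<dots> \<le> measure lebesgue (\<Union>z\<in>cell ` K. (\<lambda>x. - shift z + x) ` P z)"
    using cover \<open>finite (cell ` K)\<close> Q by (intro measure_mono_fmeasurable fmeasurable.finite_UN) auto
  also have "\<dots> \<le> (\<Sum>z\<in>cell ` K. measure lebesgue ((\<lambda>x. - shift z + x) ` P z))"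
    using \<open>finite (cell ` K)\<close> Q by (intro measure_UNION_le) auto
  also have "\<dots> = (\<Sum>z\<in>cell ` K. measure lebesgue (P z))"
    by (simp only: measure_translation)
  also have "\<dots> = measure lebesgue (\<Union>z\<in>cell ` K. P z)"
  proof (rule measure_finite_Union[symmetric])
    show "disjoint_family_on P (cell ` K)" by (auto simp: disjoint_family_on_def P_def)
    show "emeasure lebesgue (P z) \<noteq> \<infinity>" for z
      using fmeasurableD2[OF P] by simp
  qed (use P \<open>finite (cell ` K)\<close> in auto)
  also have "(\<Union>z\<in>cell ` K. P z) = K" by (auto simp: P_def)
  finally show False using less by simp
qed

text \<open>The translated lattice is closed and misses the compact \<open>K\<close>, so it lies at
  some distance d > 0 from \<open>K\<close>. If all scaled coordinates of a point of
  \<open>K\<close> were too near integers, rounding them would give a lattice point closer than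
  d.\<close>

lemma compact_lattice_gap:
  fixes K :: "(real ^ 'n::finite) set"
  assumes K: "compact K" and s: "0 < s"
    and p: "\<And>x. x \<in> K \<Longrightarrow> \<exists>i. (x $ i - p $ i) / s \<notin> \<int>"
  obtains \<eta> where "0 < \<eta>"
    "\<And>x. x \<in> K \<Longrightarrow> \<exists>i. \<eta> \<le> \<bar>(x $ i - p $ i) / s - of_int (round ((x $ i - p $ i) / s))\<bar>"
proof -
  define A where "A = {x :: real ^ 'n. \<forall>i. (x $ i - p $ i) / s \<in> \<int>}"
  have "closed ((\<lambda>x :: real ^ 'n. (x $ i - p $ i) / s) -` \<int>)" for i
    using s by (intro closed_vimage closed_Ints continuous_intros) auto
  then have "closed (\<Inter>i. (\<lambda>x :: real ^ 'n. (x $ i - p $ i) / s) -` \<int>)"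
    by blast
  also have "(\<Inter>i. (\<lambda>x :: real ^ 'n. (x $ i - p $ i) / s) -` \<int>) = A"
    by (auto simp: A_def)
  finally have "closed A" .
  moreover have "K \<inter> A = {}" using p by (auto simp: A_def)
  ultimately have "\<exists>d>0. \<forall>x\<in>K. \<forall>y\<in>A. d \<le> dist x y"
    by (intro separate_compact_closed K)
  then obtain d where d: "0 < d" "\<And>x y. x \<in> K \<Longrightarrow> y \<in> A \<Longrightarrow> d \<le> dist x y"
    by blast
  \<comment> \<open>Chosen so that n coordinate errors, each below s * \<eta>, add up to less than
    \<open>d\<close> in the l1 norm, which bounds the Euclidean distance.\<close>
  define \<eta> where "\<eta> = d / (s * real CARD('n))"
  show thesis
  proof
    show "0 < \<eta>" using d s by (simp add: \<eta>_def)
    fix x assume x: "x \<in> K"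
    define u where "u i = (x $ i - p $ i) / s" for i
    show "\<exists>i. \<eta> \<le> \<bar>(x $ i - p $ i) / s - of_int (round ((x $ i - p $ i) / s))\<bar>"
    proof (rule ccontr)
      assume "\<not> ?thesis"
      then have close: "\<bar>u i - of_int (round (u i))\<bar> < \<eta>" for i by (auto simp: u_def not_le)
      define y :: "real ^ 'n" where "y = (\<chi> i. p $ i + s * of_int (round (u i)))"
      have "y \<in> A" using s by (simp add: A_def y_def)
      have xy: "(x - y) $ i = s * (u i - of_int (round (u i)))" for i
        using s by (simp add: y_def u_def field_simps)
      have "dist x y \<le> (\<Sum>i\<in>UNIV. \<bar>(x - y) $ i\<bar>)"
        unfolding dist_norm by (rule norm_le_l1_cart)
      also have "\<dots> < (\<Sum>i\<in>(UNIV::'n set). s * \<eta>)"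
        unfolding xy using close s by (intro sum_strict_mono) (auto simp: abs_mult)
      also have "\<dots> = d" using s by (simp add: \<eta>_def)
      finally show False using d(2)[OF x \<open>y \<in> A\<close>] by simp
    qed
  qed
qed

section \<open>Null sets made of hyperplanes, and bounds on the uniform norm\<close>

text \<open>The set is a countable union of coordinate hyperplanes, each of them negligible.\<close>

lemma negligible_component_in_countable:
  fixes C :: "'n::finite \<Rightarrow> real set"
  assumes "\<And>i. countable (C i)"
  shows "negligible {x :: real ^ 'n. \<exists>i. x $ i \<in> C i}"
proof -
  have "negligible {x :: real ^ 'n. x $ i = c}" for i c
    using negligible_hyperplane[of "axis i 1 :: real ^ 'n" c]
    by (simp add: inner_axis')
  then have "negligible (\<Union>c\<in>C i. {x :: real ^ 'n. x $ i = c})" for i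
    using assms by (intro negligible_countable_Union) auto
  then have "negligible (\<Union>i. \<Union>c\<in>C i. {x :: real ^ 'n. x $ i = c})"
    by (intro negligible_countable_Union) auto
  also have "(\<Union>i. \<Union>c\<in>C i. {x :: real ^ 'n. x $ i = c}) = {x. \<exists>i. x $ i \<in> C i}"
    by auto
  finally show ?thesis .
qed

text \<open>The assumption on \<open>r\<close> matters because \<open>ennreal\<close> sends negative
  reals to 0.\<close>

lemma uniform_norm_le_iff:
  assumes "0 \<le> r"
  shows "uniform_norm f \<le> ennreal r \<longleftrightarrow> (\<forall>x. \<bar>f x\<bar> \<le> r)"
  using assms by (simp add: uniform_norm_def SUP_le_iff)

section \<open>The coordinatewise staircase map collapses the compact set\<close>

theorem lemma1p9:
  fixes K :: "(real ^ 'n::finite) set" and \<epsilon> :: real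
  assumes "compact K"
    and "measure lebesgue K \<le> \<epsilon>"
  shows "\<exists>\<phi> :: real ^ 'n \<Rightarrow> real ^ 'n.
           smooth_map \<phi> \<and>
           (\<forall>i. uniform_norm (displacement i \<phi>) \<le> ennreal (\<epsilon> powr (1 / real CARD('n)))) \<and>
           \<phi> ` K \<in> null_sets lebesgue"
proof (cases "measure lebesgue K = 0")
  \<comment> \<open>The identity serves for a null \<open>K\<close>. This includes \<epsilon> = 0,
    for which the lattice side \<open>s\<close> chosen below would be 0.\<close>
  case True
  have "smooth_map (\<lambda>x :: real ^ 'n. x)"
    by (simp add: smooth_map_def continuously_differentiable_linear)
  moreover have "K \<in> null_sets lebesgue"
    using True lmeasurable_compact[OF assms(1)] negligible_iff_measure negligible_iff_null_sets
    by blast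
  ultimately show ?thesis
    by (intro exI[of _ "\<lambda>x. x"]) (auto simp: uniform_norm_le_iff displacement_def)
next
  case False
  define r where "r = \<epsilon> powr (1 / real CARD('n))"
  \<comment> \<open>A factor above 1 makes the measure inequality strict. With 3/2, the bound s *
    (1/2 + \<delta>) is at most \<open>r\<close> as soon as \<delta> \<le> 1/6.\<close>
  define s where "s = 3 / 2 * r"
  have \<epsilon>: "0 < \<epsilon>" using False assms(2) measure_nonneg[of lebesgue K] by linarith
  then have r: "0 < r" "r ^ CARD('n) = \<epsilon>"
    by (simp_all add: r_def powr_power)
  then have s: "0 < s" by (simp add: s_def)
  have "\<epsilon> < (3 / 2) ^ CARD('n) * \<epsilon>" using \<epsilon> by simp
  then have "measure lebesgue K < s ^ CARD('n)"
    using assms(2) r(2) by (simp only: s_def power_mult_distrib)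
  then obtain p :: "real ^ 'n" where p: "\<And>x. x \<in> K \<Longrightarrow> \<exists>i. (x $ i - p $ i) / s \<notin> \<int>"
    using exists_translated_lattice_disjoint[OF assms(1) s] by blast
  obtain \<eta> where \<eta>: "0 < \<eta>"
    "\<And>x. x \<in> K \<Longrightarrow> \<exists>i. \<eta> \<le> \<bar>(x $ i - p $ i) / s - of_int (round ((x $ i - p $ i) / s))\<bar>"
    using compact_lattice_gap[OF assms(1) s p] by blast
  \<comment> \<open>The bound \<eta> puts some coordinate of each point of \<open>K\<close> on a
    plateau; 1/6 keeps the displacement at most \<open>r\<close>.\<close>
  define \<delta> where "\<delta> = min \<eta> (1/6)"
  have \<delta>: "0 < \<delta>" "\<delta> < 1/2" "\<delta> \<le> 1/6" "\<delta> \<le> \<eta>" using \<eta>(1) by (auto simp: \<delta>_def)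
  define \<phi> :: "real ^ 'n \<Rightarrow> real ^ 'n" where
    "\<phi> x = (\<chi> i. p $ i + s * smooth_staircase \<delta> ((x $ i - p $ i) / s))" for x
  have "smooth_map \<phi>"
    unfolding \<phi>_def
  proof (rule smooth_map_componentwise)
    fix i :: 'n
    have "bounded_linear (\<lambda>x :: real ^ 'n. x $ i / s)"
      using bounded_linear_compose[OF bounded_linear_divide bounded_linear_vec_nth] .
    \<comment> \<open>The scaled coordinate is rewritten as a constant plus a linear map, as affine
      precomposition requires.\<close>
    then have "continuously_differentiable k (\<lambda>x :: real ^ 'n. p $ i + s * smooth_staircase \<delta> (- p $ i / s + x $ i / s))" for k
      by (intro continuously_differentiable_add continuously_differentiable_mult
          continuously_differentiable_const continuously_differentiable_compose_affine
          continuously_differentiable_smooth_staircase \<delta>)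
    then show "smooth_map (\<lambda>x :: real ^ 'n. p $ i + s * smooth_staircase \<delta> ((x $ i - p $ i) / s))"
      by (simp add: smooth_map_def diff_divide_distrib)
  qed
  moreover have "uniform_norm (displacement i \<phi>) \<le> ennreal r" for i
  proof -
    have "\<bar>x $ i - \<phi> x $ i\<bar> \<le> r" for x
    proof -
      define u where "u = (x $ i - p $ i) / s"
      have "x $ i - \<phi> x $ i = s * (u - smooth_staircase \<delta> u)"
        using s by (simp add: \<phi>_def u_def[symmetric] right_diff_distrib) (simp add: u_def)
      then have "\<bar>x $ i - \<phi> x $ i\<bar> = s * \<bar>u - smooth_staircase \<delta> u\<bar>"
        using s by (simp add: abs_mult)
      also have "\<dots> \<le> s * (1/2 + 1/6)"
        using s \<delta> abs_smooth_staircase_diff_le[OF \<delta>(1), of u] by (intro mult_left_mono) auto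
      also have "\<dots> = r" by (simp add: s_def)
      finally show ?thesis .
    qed
    then show ?thesis
      using r by (simp add: uniform_norm_le_iff displacement_def)
  qed
  moreover have "\<phi> ` K \<in> null_sets lebesgue"
  proof -
    \<comment> \<open>These are the plateau heights in coordinate \<open>i\<close>: the midpoints
      between consecutive lattice values.\<close>
    define C where "C i = range (\<lambda>k. p $ i + s * (of_int k + 1/2))" for i
    have "\<phi> x \<in> {y. \<exists>i. y $ i \<in> C i}" if "x \<in> K" for x
    proof -
      obtain i where i: "\<eta> \<le> \<bar>(x $ i - p $ i) / s - of_int (round ((x $ i - p $ i) / s))\<bar>"
        using \<eta>(2)[OF \<open>x \<in> K\<close>] by blast
      define u where "u = (x $ i - p $ i) / s"
      \<comment> \<open>Left of the nearest integer the height is round u - 1/2 = (round u - 1) +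
        1/2, hence the index shifted by one.\<close>
      have "smooth_staircase \<delta> u = of_int (if u < of_int (round u) then round u - 1 else round u) + 1/2"
        using smooth_staircase_flat[OF \<delta>(1), of u] i \<delta>(4) by (simp add: u_def)
      then have "\<phi> x $ i \<in> C i"
        unfolding C_def
        by (intro image_eqI[of _ _ "if u < of_int (round u) then round u - 1 else round u"])
          (simp_all add: \<phi>_def u_def)
      then show ?thesis by blast
    qed
    then have "\<phi> ` K \<subseteq> {y. \<exists>i. y $ i \<in> C i}" by blast
    moreover have "negligible {y :: real ^ 'n. \<exists>i. y $ i \<in> C i}"
      by (rule negligible_component_in_countable) (simp add: C_def)
    ultimately show ?thesis
      using negligible_subset negligible_iff_null_sets by blast
  qed
  ultimately show ?thesis
    unfolding r_def by blast
qed

end
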